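(* Let $I\subset\mathbb{R}$ be an open interval, let $\gamma:I\to\mathbb{R}^2\setminus\{0\}$ be a smooth unit speed curve with unit normal $n$ such that $\langle\gamma(s),n(s)\rangle\neq0$ for all $s\in I$, and let $\phi\in\mathbb{R}$. Then for all $s\in I$ $$\mathrm{Pr}[\phi]_\gamma(s)=\cos\phi\,\bigl(\cos\phi\,\mathrm{Pr}_\gamma(s)+\sin\phi\,\mathrm{Pr}_{J\gamma}(s)\bigr).$$
   Context: $J=\begin{pmatrix}0&-1\\1&0\end{pmatrix}$. For a unit speed curve $c$: $t_c=c'$, $n_c=Jt_c$ (for $\gamma$, $n=n_\gamma$). $J\gamma$ is the unit speed curve $s\mapsto J(\gamma(s))$. Primitive: for a unit speed curve $c:I\to\mathbb{R}^2\setminus\{0\}$ with $\langle c,n_c\rangle\neq0$, $\mathrm{Pr}_c(s)=2c(s)-\frac{\|c(s)\|^2}{\langle n_c(s),c(s)\rangle}n_c(s)$, which is the envelope of the lines $\{x:\langle x-c(s),c(s)\rangle=0\}_{s\in I}$. $\phi$-slant primitivoid: put $\mathbb{N}[\phi](s)=\cos\phi\,\gamma(s)+\sin\phi\,J\gamma(s)$ and $F(s,x)=\langle x-\gamma(s),\mathbb{N}[\phi](s)\rangle$ for $(s,x)\in I\times\mathbb{R}^2$. $\mathrm{Pr}[\phi]_\gamma$ is the envelope of the lines $\{x:F(s,x)=0\}_{s\in I}$, i.e. $\mathrm{Pr}[\phi]_\gamma(s)$ is the unique point $x\in\mathbb{R}^2$ with $F(s,x)=\frac{\partial F}{\partial s}(s,x)=0$.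 *)

theory Defs
  imports "HOL-Analysis.Analysis"
begin

definition J :: "real^2^2" where
  "J = vector [vector [0, -1], vector [1, 0]]"

text \<open>Curves are total functions of which only the values on the parameter interval matter.
  All derivatives below are two-sided; as they are only taken at points of an open set \<open>I\<close>,
  they do not depend on the values of the curve outside \<open>I\<close>.\<close>

definition tangent :: "(real \<Rightarrow> real^2) \<Rightarrow> real \<Rightarrow> real^2" where
  "tangent c s = vector_derivative c (at s)"

definition normal_vec :: "(real \<Rightarrow> real^2) \<Rightarrow> real \<Rightarrow> real^2" where
  "normal_vec c s = J *v tangent c s"

text \<open>\<open>(tangent ^^ k) c\<close> is the \<open>k\<close>-th derivative of \<open>c\<close>, so this is
  \<open>C\<^sup>\<infinity>\<close>-smoothness.\<close>

definition smooth_curve_on :: "real set \<Rightarrow> (real \<Rightarrow> real^2) \<Rightarrow> bool" where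
  "smooth_curve_on I c \<longleftrightarrow> (\<forall>k. \<forall>s\<in>I. (tangent ^^ k) c differentiable (at s))"

definition unit_speed_on :: "real set \<Rightarrow> (real \<Rightarrow> real^2) \<Rightarrow> bool" where
  "unit_speed_on I c \<longleftrightarrow> (\<forall>s\<in>I. norm (tangent c s) = 1)"

definition primitive :: "(real \<Rightarrow> real^2) \<Rightarrow> real \<Rightarrow> real^2" where
  "primitive c s =
     2 *\<^sub>R c s - ((norm (c s))\<^sup>2 / (normal_vec c s \<bullet> c s)) *\<^sub>R normal_vec c s"

text \<open>The envelope of the lines \<open>{x. F s x = 0}\<close>. It is meaningful at \<open>s\<close> only if the point
  described exists and is unique.\<close>

definition envelope :: "(real \<Rightarrow> real^2 \<Rightarrow> real) \<Rightarrow> real \<Rightarrow> real^2" where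
  "envelope F s =
     (THE x. F s x = 0 \<and> ((\<lambda>u. F u x) has_real_derivative 0) (at s))"

definition slant_vec :: "real \<Rightarrow> (real \<Rightarrow> real^2) \<Rightarrow> real \<Rightarrow> real^2" where
  "slant_vec \<phi> c s = cos \<phi> *\<^sub>R c s + sin \<phi> *\<^sub>R (J *v c s)"

definition slant_primitivoid :: "real \<Rightarrow> (real \<Rightarrow> real^2) \<Rightarrow> real \<Rightarrow> real^2" where
  "slant_primitivoid \<phi> c = envelope (\<lambda>s x. (x - c s) \<bullet> slant_vec \<phi> c s)"

end

theory Submission
  imports Defs
begin

text \<open>Write \<open>R\<close> for the rotation by \<open>\<phi>\<close>, so that the slant vector is \<open>R \<gamma>\<close>. Since
  \<open>\<gamma> \<bullet> R \<gamma> = cos \<phi> \<parallel>\<gamma>\<parallel>\<^sup>2\<close>, the two equations of the envelope are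
  \<open>x \<bullet> R \<gamma> = cos \<phi> \<parallel>\<gamma>\<parallel>\<^sup>2\<close> and \<open>x \<bullet> R \<gamma>' = 2 cos \<phi> (\<gamma> \<bullet> \<gamma>')\<close>, a linear system with
  determinant \<open>R \<gamma> \<bullet> J R \<gamma>' = \<gamma> \<bullet> n \<noteq> 0\<close>. As \<open>Pr\<close> satisfies \<open>Pr \<bullet> \<gamma> = \<parallel>\<gamma>\<parallel>\<^sup>2\<close> and
  \<open>Pr \<bullet> \<gamma>' = 2 (\<gamma> \<bullet> \<gamma>')\<close>, and \<open>R\<close> is an isometry, the solution is \<open>cos \<phi> R Pr\<close>; finally
  \<open>J Pr\<close> is the primitive of \<open>J \<gamma>\<close>.\<close>

lemma J_mult_component [simp]:
  "(J *v x) $ 1 = - x $ 2" "(J *v x) $ 2 = x $ 1"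
  by (simp_all add: J_def matrix_vector_mult_def sum_2)

lemma inner_vec2: "x \<bullet> y = x $ 1 * y $ 1 + x $ 2 * y $ 2" for x y :: "real^2"
  by (simp add: inner_vec_def sum_2)

lemma J_mult_J_mult [simp]: "J *v (J *v x) = - x"
  by (simp add: vec_eq_iff forall_2)

lemma inner_J_mult_J_mult [simp]: "(J *v x) \<bullet> (J *v y) = x \<bullet> y"
  by (simp add: inner_vec2)

lemma inner_J_mult_self [simp]: "x \<bullet> (J *v x) = 0" "(J *v x) \<bullet> x = 0"
  by (simp_all add: inner_vec2)

lemma inner_J_mult_left: "(J *v x) \<bullet> y = - (x \<bullet> (J *v y))"
  by (simp add: inner_vec2)

lemma norm_J_mult [simp]: "norm (J *v x) = norm x"
  by (simp add: norm_eq_sqrt_inner)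

text \<open>Cramer's rule: \<open>a \<bullet> (J *v b)\<close> is minus the determinant of
  \<open>a\<close> and \<open>b\<close>, and this multiple of \<open>z\<close> is a combination
  whose coefficients are \<open>z \<bullet> a\<close> and \<open>z \<bullet> b\<close>.\<close>

lemma eq_0_if_orthogonal_to_basis:
  fixes a b z :: "real^2"
  assumes "a \<bullet> (J *v b) \<noteq> 0" "z \<bullet> a = 0" "z \<bullet> b = 0"
  shows "z = 0"
proof -
  have "(a \<bullet> (J *v b)) *\<^sub>R z = (z \<bullet> a) *\<^sub>R (J *v b) - (z \<bullet> b) *\<^sub>R (J *v a)"
    by (simp add: vec_eq_iff forall_2 inner_vec2 algebra_simps)
  with assms show ?thesis by simp
qed

text \<open>Rotations are isometries: the mixed terms cancel because \<open>J\<close> is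
  skew.\<close>

lemma inner_slant_vec_slant_vec:
  "slant_vec \<phi> c s \<bullet> slant_vec \<phi> d s = c s \<bullet> d s"
proof -
  have "slant_vec \<phi> c s \<bullet> slant_vec \<phi> d s =
      (cos \<phi>)\<^sup>2 * (c s \<bullet> d s) + (sin \<phi>)\<^sup>2 * (c s \<bullet> d s)"
    by (simp add: slant_vec_def inner_add_left inner_add_right inner_J_mult_left
        power2_eq_square algebra_simps)
  also have "\<dots> = c s \<bullet> d s"
    by (simp flip: distrib_right)
  finally show ?thesis .
qed

lemma J_mult_slant_vec: "J *v slant_vec \<phi> c s = slant_vec \<phi> (\<lambda>u. J *v c u) s"
  by (simp add: slant_vec_def matrix_vector_right_distrib matrix_vector_mult_scaleR)

lemma inner_slant_vec_self: "c s \<bullet> slant_vec \<phi> c s = cos \<phi> * (norm (c s))\<^sup>2"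
  by (simp add: slant_vec_def inner_add_right power2_norm_eq_inner)

lemma has_vector_derivative_J_mult:
  assumes "(c has_vector_derivative c') F"
  shows "((\<lambda>u. J *v c u) has_vector_derivative J *v c') F"
  using bounded_linear.has_vector_derivative[OF matrix_vector_mul_bounded_linear assms] .

lemma has_vector_derivative_slant_vec:
  assumes "(c has_vector_derivative tangent c s) (at s)"
  shows "(slant_vec \<phi> c has_vector_derivative slant_vec \<phi> (tangent c) s) (at s)"
  unfolding slant_vec_def [abs_def]
  by (intro has_vector_derivative_add assms
      has_vector_derivative_J_mult bounded_linear.has_vector_derivative[OF bounded_linear_scaleR_right])

text \<open>The formula for \<open>primitive\<close> uses only norms, inner products and the normal;
  the first two are \<open>J\<close>-invariant, and the normal turns with the curve because the
  linear map \<open>J\<close> commutes with differentiation.\<close>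

lemma primitive_J_mult:
  assumes "c differentiable (at s)"
  shows "primitive (\<lambda>u. J *v c u) s = J *v primitive c s"
proof -
  have "tangent (\<lambda>u. J *v c u) s = J *v tangent c s"
    using assms unfolding tangent_def vector_derivative_works
    by (intro vector_derivative_at has_vector_derivative_J_mult)
  then have "normal_vec (\<lambda>u. J *v c u) s = J *v normal_vec c s"
    by (simp add: normal_vec_def)
  then show ?thesis
    by (simp add: primitive_def matrix_vector_mult_diff_distrib matrix_vector_mult_scaleR)
qed

lemma inner_primitive_curve:
  assumes "c s \<bullet> normal_vec c s \<noteq> 0"
  shows "primitive c s \<bullet> c s = (norm (c s))\<^sup>2"
  using assms inner_commute[of "c s" "normal_vec c s"]
  by (simp add: primitive_def inner_diff_left power2_norm_eq_inner)

text \<open>The second term of \<open>primitive\<close> is normal to the curve, so only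
  \<open>2 *\<^sub>R c s\<close> contributes.\<close>

lemma inner_primitive_tangent: "primitive c s \<bullet> tangent c s = 2 * (c s \<bullet> tangent c s)"
  by (simp add: primitive_def inner_diff_left normal_vec_def)

lemma slant_family_derivative:
  assumes "c differentiable (at s)"
  shows "((\<lambda>u. (x - c u) \<bullet> slant_vec \<phi> c u) has_real_derivative
    x \<bullet> slant_vec \<phi> (tangent c) s - 2 * cos \<phi> * (c s \<bullet> tangent c s)) (at s)"
proof -
  have c: "(c has_vector_derivative tangent c s) (at s)"
    using assms by (simp add: tangent_def vector_derivative_works)
  \<comment> \<open>Separating off the part independent of \<open>x\<close> leaves a term linear in
    \<open>x\<close> and a multiple of \<open>c u \<bullet> c u\<close>.\<close>
  have "(\<lambda>u. (x - c u) \<bullet> slant_vec \<phi> c u) = (\<lambda>u. x \<bullet> slant_vec \<phi> c u - cos \<phi> * (c u \<bullet> c u))"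
    by (simp add: inner_diff_left inner_slant_vec_self power2_norm_eq_inner)
  moreover have "((\<lambda>u. x \<bullet> slant_vec \<phi> c u - cos \<phi> * (c u \<bullet> c u)) has_vector_derivative
      x \<bullet> slant_vec \<phi> (tangent c) s - cos \<phi> * (c s \<bullet> tangent c s + tangent c s \<bullet> c s)) (at s)"
    by (intro has_vector_derivative_diff
        bounded_linear.has_vector_derivative[OF bounded_linear_inner_right]
        bounded_linear.has_vector_derivative[OF bounded_linear_mult_right]
        bounded_bilinear.has_vector_derivative[OF bounded_bilinear_inner]
        has_vector_derivative_slant_vec c)
  ultimately show ?thesis
    by (simp add: has_real_derivative_iff_has_vector_derivative inner_commute algebra_simps)
qed

lemma slant_primitivoid_eq_slant_vec:
  assumes diff: "c differentiable (at s)" and nz: "c s \<bullet> normal_vec c s \<noteq> 0"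
  shows "slant_primitivoid \<phi> c s = cos \<phi> *\<^sub>R slant_vec \<phi> (primitive c) s"
  unfolding slant_primitivoid_def envelope_def
proof (rule the_equality)
  let ?y = "cos \<phi> *\<^sub>R slant_vec \<phi> (primitive c) s"
  \<comment> \<open>Uniqueness of derivatives turns the envelope condition into two linear equations
    in \<open>x\<close>.\<close>
  have envelope_iff: "(x - c s) \<bullet> slant_vec \<phi> c s = 0 \<and>
      ((\<lambda>u. (x - c u) \<bullet> slant_vec \<phi> c u) has_real_derivative 0) (at s) \<longleftrightarrow>
      x \<bullet> slant_vec \<phi> c s = cos \<phi> * (norm (c s))\<^sup>2 \<and>
      x \<bullet> slant_vec \<phi> (tangent c) s = 2 * cos \<phi> * (c s \<bullet> tangent c s)" for x
    using slant_family_derivative[OF diff, of x \<phi>]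
    by (auto simp: inner_diff_left inner_slant_vec_self dest: DERIV_unique)
  have y: "?y \<bullet> slant_vec \<phi> c s = cos \<phi> * (norm (c s))\<^sup>2"
      "?y \<bullet> slant_vec \<phi> (tangent c) s = 2 * cos \<phi> * (c s \<bullet> tangent c s)"
    using nz by (simp_all add: inner_slant_vec_slant_vec inner_primitive_curve inner_primitive_tangent)
  then show "(?y - c s) \<bullet> slant_vec \<phi> c s = 0 \<and>
      ((\<lambda>u. (?y - c u) \<bullet> slant_vec \<phi> c u) has_real_derivative 0) (at s)"
    using envelope_iff by blast
  fix x
  assume "(x - c s) \<bullet> slant_vec \<phi> c s = 0 \<and>
      ((\<lambda>u. (x - c u) \<bullet> slant_vec \<phi> c u) has_real_derivative 0) (at s)"
  with y have "(x - ?y) \<bullet> slant_vec \<phi> c s = 0" "(x - ?y) \<bullet> slant_vec \<phi> (tangent c) s = 0"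
    unfolding envelope_iff by (simp_all only: inner_diff_left diff_self)
  \<comment> \<open>\<open>J\<close> commutes with the rotation, so this reduces to
    \<open>nz\<close>.\<close>
  moreover have "slant_vec \<phi> c s \<bullet> (J *v slant_vec \<phi> (tangent c) s) \<noteq> 0"
    using nz by (simp add: J_mult_slant_vec inner_slant_vec_slant_vec normal_vec_def)
  ultimately have "x - ?y = 0"
    by (intro eq_0_if_orthogonal_to_basis)
  then show "x = ?y" by simp
qed

theorem theorem4p1:
  fixes I :: "real set" and \<gamma> :: "real \<Rightarrow> real^2" and \<phi> :: real
  assumes "open I" and "is_interval I"
    and "smooth_curve_on I \<gamma>"
    and "unit_speed_on I \<gamma>"
    and "\<forall>s\<in>I. \<gamma> s \<noteq> 0"
    and "\<forall>s\<in>I. \<gamma> s \<bullet> normal_vec \<gamma> s \<noteq> 0"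
  shows "\<forall>s\<in>I. slant_primitivoid \<phi> \<gamma> s =
    cos \<phi> *\<^sub>R (cos \<phi> *\<^sub>R primitive \<gamma> s
      + sin \<phi> *\<^sub>R primitive (\<lambda>u. J *v \<gamma> u) s)"
proof
  fix s assume s: "s \<in> I"
  have "((tangent ^^ 0) \<gamma>) differentiable (at s)"
    using assms(3) s unfolding smooth_curve_on_def by blast
  then have "\<gamma> differentiable (at s)" by simp
  then show "slant_primitivoid \<phi> \<gamma> s =
    cos \<phi> *\<^sub>R (cos \<phi> *\<^sub>R primitive \<gamma> s
      + sin \<phi> *\<^sub>R primitive (\<lambda>u. J *v \<gamma> u) s)"
    using assms(6) s
    by (simp add: slant_primitivoid_eq_slant_vec primitive_J_mult slant_vec_def)
qed

end
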